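(* Let $H$ be a real Hilbert space and let $A,B,C\colon H\rightrightarrows H$ be monotone operators. (1) If $A$ is $\mu_A$-strongly monotone and $C$ is $L_C$-Lipschitz with $\mu_A,L_C\in(0,\infty)$, and $\alpha\in(0,2\mu_A/L_C^2)$, then $T_{A,B,C,\alpha,1}$ is $\frac{2}{4-\alpha L_C^2/\mu_A}$-averaged. (2) Symmetrically, if $B$ is $\mu_B$-strongly monotone and $C$ is $L_C$-Lipschitz with $\mu_B,L_C\in(0,\infty)$, and $\alpha\in(0,2\mu_B/L_C^2)$, then $T_{A,B,C,\alpha,1}$ is $\frac{2}{4-\alpha L_C^2/\mu_B}$-averaged.
   Context: A (multi-valued) operator $A\colon H\rightrightarrows H$ is identified with its graph, a subset of $H\times H$; $u\in Ax$ means $(x,u)\in A$, and $\mathrm{dom}\,A=\{x:Ax\ne\emptyset\}$. Operators need not have full domain and monotone operators need not be maximal. Set $A^{-1}=\{(u,x):(x,u)\in A\}$, $A+B=\{(x,u+v):(x,u)\in A,(x,v)\in B\}$, $AB=\{(x,s):\exists u,\ (x,u)\in B,\ (u,s)\in A\}$, $I$ the identity, and $J_{\alpha A}=(I+\alpha A)^{-1}$ the resolvent. For all $u\in Ax$, $v\in Ay$: $A$ is monotone if $\langle x-y,u-v\rangle\ge0$; $\mu$-strongly monotone if $\langle x-y,u-v\rangle\ge\mu\|x-y\|^2$; $L$-Lipschitz if $\|u-v\|\le L\|x-y\|$ (such operators are single-valued on their domain $\mathrm{dom}\,A\subseteq H$). For $\theta\in(0,1)$, an operator $T$ is $\theta$-averaged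 if $T=(1-\theta)I+\theta N$ for some $1$-Lipschitz operator $N\colon\mathrm{dom}\,N\to H$, $\mathrm{dom}\,N\subseteq H$ (so $\mathrm{dom}\,N=\mathrm{dom}\,T$). The Davis–Yin splitting operator with stepsize $\alpha>0$ and averaging parameter $\lambda=1$ is $$T_{A,B,C,\alpha,1}=I-J_{\alpha B}+J_{\alpha A}(2J_{\alpha B}-I-\alpha CJ_{\alpha B}).$$ *)

theory Defs
  imports "HOL-Analysis.Inner_Product"
begin

text \<open>
  A multi-valued operator is its graph, a relation on \<open>'a\<close>.  The identity, the inverse and the
  domain are \<^const>\<open>Id\<close>, \<^const>\<open>converse\<close> and \<^const>\<open>Domain\<close>.  Relational composition is written
  in the opposite order: the operator product $AB$ (first $B$, then $A$) is \<open>B O A\<close>.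
\<close>

definition op_add :: "('a::plus) rel \<Rightarrow> 'a rel \<Rightarrow> 'a rel"  (infixl "\<oplus>" 65) where
  "A \<oplus> B = {(x, u + v) | x u v. (x, u) \<in> A \<and> (x, v) \<in> B}"

definition op_scale :: "real \<Rightarrow> ('a::real_vector) rel \<Rightarrow> 'a rel"  (infixr "\<odot>" 75) where
  "\<alpha> \<odot> A = {(x, \<alpha> *\<^sub>R u) | x u. (x, u) \<in> A}"

abbreviation op_diff :: "('a::real_vector) rel \<Rightarrow> 'a rel \<Rightarrow> 'a rel"  (infixl "\<ominus>" 65) where
  "A \<ominus> B \<equiv> A \<oplus> (- 1) \<odot> B"

abbreviation op_comp :: "'a rel \<Rightarrow> 'a rel \<Rightarrow> 'a rel"  (infixr "\<otimes>" 75) where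
  "A \<otimes> B \<equiv> B O A"

definition resolvent :: "('a::real_vector) rel \<Rightarrow> 'a rel" where
  "resolvent A = (Id \<oplus> A)\<inverse>"

definition monotone_op :: "('a::real_inner) rel \<Rightarrow> bool" where
  "monotone_op A \<longleftrightarrow> (\<forall>x u y v. (x, u) \<in> A \<longrightarrow> (y, v) \<in> A \<longrightarrow> inner (x - y) (u - v) \<ge> 0)"

definition strongly_monotone_op :: "real \<Rightarrow> ('a::real_inner) rel \<Rightarrow> bool" where
  "strongly_monotone_op \<mu> A \<longleftrightarrow>
     (\<forall>x u y v. (x, u) \<in> A \<longrightarrow> (y, v) \<in> A \<longrightarrow> inner (x - y) (u - v) \<ge> \<mu> * (norm (x - y))\<^sup>2)"

definition lipschitz_op :: "real \<Rightarrow> ('a::real_normed_vector) rel \<Rightarrow> bool" where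
  "lipschitz_op L A \<longleftrightarrow>
     (\<forall>x u y v. (x, u) \<in> A \<longrightarrow> (y, v) \<in> A \<longrightarrow> norm (u - v) \<le> L * norm (x - y))"

text \<open>
  \<open>N\<close> need not be defined everywhere.  Being Lipschitz, it is single-valued on its domain, and the
  equation of graphs forces \<open>Domain N = Domain T\<close>.
\<close>

definition averaged_op :: "real \<Rightarrow> ('a::real_normed_vector) rel \<Rightarrow> bool" where
  "averaged_op \<theta> T \<longleftrightarrow>
     0 < \<theta> \<and> \<theta> < 1 \<and> (\<exists>N. lipschitz_op 1 N \<and> T = (1 - \<theta>) \<odot> Id \<oplus> \<theta> \<odot> N)"

text \<open>The Davis--Yin operator with stepsize \<open>\<alpha>\<close> and averaging parameter \<open>1\<close>.\<close>

definition davis_yin :: "('a::real_vector) rel \<Rightarrow> 'a rel \<Rightarrow> 'a rel \<Rightarrow> real \<Rightarrow> 'a rel" where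
  "davis_yin A B C \<alpha> =
     (let JA = resolvent (\<alpha> \<odot> A); JB = resolvent (\<alpha> \<odot> B)
      in Id \<ominus> JB \<oplus> JA \<otimes> (2 \<odot> JB \<ominus> Id \<ominus> \<alpha> \<odot> C \<otimes> JB))"

end

theory Submission imports Defs
begin

text \<open>
  Write \<open>z, b, x, u, c, t\<close> for the differences, between two evaluations, of the argument, of the
  points at which \<open>B\<close> and \<open>A\<close> are evaluated, of \<open>\<alpha>\<close> times the values of \<open>B\<close>, of the values of \<open>C\<close>,
  and of the result.  Then \<open>z = b + u\<close>, \<open>t = u + x\<close>, and \<open>\<alpha>\<close> times the values of \<open>A\<close> differ by
  \<open>b - x - u - \<alpha> c\<close>.  Averagedness of the operator amounts to
  \<open>\<parallel>u + x\<parallel>\<^sup>2 \<le> \<parallel>b + u\<parallel>\<^sup>2 - (1 - k / 2) \<parallel>b - x\<parallel>\<^sup>2\<close> with \<open>k = \<alpha> L\<^sup>2 / \<mu>\<close>.  Expanding, and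
  using (strong) monotonicity of \<open>A\<close> and \<open>B\<close>, reduces it to the nonnegativity of
  \<open>2 \<mu> \<parallel>y\<parallel>\<^sup>2 + 2 \<langle>x, c\<rangle> + L\<^sup>2 / (2 \<mu>) \<parallel>b - x\<parallel>\<^sup>2\<close>, where \<open>y\<close> is \<open>x\<close> or \<open>b\<close> according to which operator is
  strongly monotone.  That follows by completing squares from \<open>\<parallel>c\<parallel> \<le> L \<parallel>b\<parallel>\<close> and \<open>\<langle>b, c\<rangle> \<ge> 0\<close>.
\<close>

lemma mem_op_add_iff: "(x, w) \<in> A \<oplus> B \<longleftrightarrow> (\<exists>u v. (x, u) \<in> A \<and> (x, v) \<in> B \<and> w = u + v)"
  by (auto simp: op_add_def)

lemma mem_op_scale_iff: "(x, w) \<in> \<alpha> \<odot> A \<longleftrightarrow> (\<exists>u. (x, u) \<in> A \<and> w = \<alpha> *\<^sub>R u)"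
  by (auto simp: op_scale_def)

lemma mem_resolvent_iff: "(z, x) \<in> resolvent (\<alpha> \<odot> A) \<longleftrightarrow> (\<exists>u. (x, u) \<in> A \<and> z = x + \<alpha> *\<^sub>R u)"
  by (auto simp: resolvent_def mem_op_add_iff mem_op_scale_iff)

text \<open>With \<open>z\<close> and \<open>r\<close> the differences of the arguments and of
  argument minus value, both the assumed inequality and nonexpansiveness of the forced choice of
  \<open>N\<close> expand to \<parallel>r\<parallel>^2 \<le> 2 \<theta> \<langle>z,
  r\<rangle>.\<close>

lemma averaged_opI:
  fixes T :: "('a::real_inner) rel"
  assumes "0 < \<theta>" "\<theta> < 1"
    and ineq: "\<And>x t y s. (x, t) \<in> T \<Longrightarrow> (y, s) \<in> T \<Longrightarrow>
      (norm (t - s))\<^sup>2 \<le> (norm (x - y))\<^sup>2 - (1 - \<theta>) / \<theta> * (norm ((x - t) - (y - s)))\<^sup>2"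
  shows "averaged_op \<theta> T"
proof -
  \<comment> \<open>Solving t = (1 - \<theta>) x + \<theta> n for n gives \<open>f x t\<close>. It
    takes both coordinates because \<open>T\<close> is a relation.\<close>
  define f where "f x t = (1 / \<theta>) *\<^sub>R (t - (1 - \<theta>) *\<^sub>R x)" for x t :: 'a
  define N where "N = {(x, f x t) | x t. (x, t) \<in> T}"
  have f: "(1 - \<theta>) *\<^sub>R x + \<theta> *\<^sub>R f x t = t" for x t
    using \<open>0 < \<theta>\<close> by (simp add: f_def)
  have "T = (1 - \<theta>) \<odot> Id \<oplus> \<theta> \<odot> N"
  proof (rule set_eqI, clarify)
    fix x t
    show "(x, t) \<in> T \<longleftrightarrow> (x, t) \<in> (1 - \<theta>) \<odot> Id \<oplus> \<theta> \<odot> N"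
      unfolding mem_op_add_iff mem_op_scale_iff N_def by (simp, safe) (blast intro: f[symmetric], simp add: f)
  qed
  moreover have "norm (f x t - f y s) \<le> norm (x - y)" if "(x, t) \<in> T" "(y, s) \<in> T" for x t y s
  proof (rule power2_le_imp_le)
    define z r where "z = x - y" and "r = (x - t) - (y - s)"
    have ts: "t - s = z - r"
      by (simp add: z_def r_def)
    have "(norm (z - r))\<^sup>2 \<le> (norm z)\<^sup>2 - (1 - \<theta>) / \<theta> * (norm r)\<^sup>2"
      using ineq[OF that] unfolding ts r_def[symmetric] z_def[symmetric] .
    then have "\<theta> * (norm (z - r))\<^sup>2 \<le> \<theta> * (norm z)\<^sup>2 - (1 - \<theta>) * (norm r)\<^sup>2"
      using \<open>0 < \<theta>\<close> by (simp add: field_simps)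
    then have *: "(norm r)\<^sup>2 \<le> 2 * \<theta> * inner z r"
      by (simp add: power2_norm_eq_inner inner_diff inner_commute algebra_simps)
    have "f x t - f y s = (1 / \<theta>) *\<^sub>R ((t - s) - (1 - \<theta>) *\<^sub>R z)"
      by (simp add: f_def z_def algebra_simps)
    also have "(t - s) - (1 - \<theta>) *\<^sub>R z = \<theta> *\<^sub>R z - r"
      by (simp add: ts algebra_simps)
    finally have "(norm (f x t - f y s))\<^sup>2 = (norm (\<theta> *\<^sub>R z - r))\<^sup>2 / \<theta>\<^sup>2"
      using \<open>0 < \<theta>\<close> by (simp add: power_divide)
    also have "(norm (\<theta> *\<^sub>R z - r))\<^sup>2 = \<theta>\<^sup>2 * (norm z)\<^sup>2 - 2 * \<theta> * inner z r + (norm r)\<^sup>2"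
      unfolding power2_norm_eq_inner
      by (simp add: inner_diff inner_commute algebra_simps power2_eq_square)
    also have "\<dots> / \<theta>\<^sup>2 \<le> (norm z)\<^sup>2"
      using * \<open>0 < \<theta>\<close> by (simp add: field_simps)
    finally show "(norm (f x t - f y s))\<^sup>2 \<le> (norm (x - y))\<^sup>2"
      by (simp add: z_def)
  qed simp
  then have "lipschitz_op 1 N"
    by (auto simp: lipschitz_op_def N_def)
  ultimately show ?thesis
    using assms(1,2) unfolding averaged_op_def by blast
qed

lemma resolvent_single_valued:
  fixes B :: "('a::real_inner) rel"
  assumes "monotone_op B" "0 \<le> \<alpha>"
  shows "single_valued (resolvent (\<alpha> \<odot> B))"
proof (rule single_valuedI)
  fix z x y assume "(z, x) \<in> resolvent (\<alpha> \<odot> B)" "(z, y) \<in> resolvent (\<alpha> \<odot> B)"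
  then obtain u v where uv: "(x, u) \<in> B" "(y, v) \<in> B" "z = x + \<alpha> *\<^sub>R u" "z = y + \<alpha> *\<^sub>R v"
    by (auto simp: mem_resolvent_iff)
  then have "x - y = - \<alpha> *\<^sub>R (u - v)"
    by (simp add: algebra_simps)
  then have "inner (x - y) (x - y) = - \<alpha> * inner (x - y) (u - v)"
    by (metis inner_scaleR_right)
  also have "\<dots> \<le> 0"
    using assms uv by (simp add: monotone_op_def)
  finally have "inner (x - y) (x - y) \<le> 0" .
  then show "x = y"
    using inner_ge_zero[of "x - y"] inner_eq_zero_iff[of "x - y"] by auto
qed

text \<open>As a relation, the operator may pick a different value of the resolvent of
  \<open>B\<close> at each of its three occurrences. Single-valuedness merges them into one point
  \<open>b\<close>.\<close>

lemma davis_yinE: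
  fixes A B C :: "('a::real_inner) rel"
  assumes "(z, t) \<in> davis_yin A B C \<alpha>" "monotone_op B" "0 \<le> \<alpha>"
  obtains b u c x a where "(b, u) \<in> B" "(b, c) \<in> C" "(x, a) \<in> A" "z = b + \<alpha> *\<^sub>R u"
    "\<alpha> *\<^sub>R a = b - x - \<alpha> *\<^sub>R u - \<alpha> *\<^sub>R c" "t = \<alpha> *\<^sub>R u + x"
proof -
  define JB where "JB = resolvent (\<alpha> \<odot> B)"
  obtain b b' b'' c w x where b: "(z, b) \<in> JB" "(z, b') \<in> JB" "(z, b'') \<in> JB"
    and "(b'', c) \<in> C" "w = 2 *\<^sub>R b' - z - \<alpha> *\<^sub>R c"
    and w: "(w, x) \<in> resolvent (\<alpha> \<odot> A)" and "t = z - b + x"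
    using assms(1) unfolding davis_yin_def Let_def JB_def[symmetric]
    by (clarsimp simp: mem_op_add_iff mem_op_scale_iff)
  moreover have "b' = b" "b'' = b"
    using b resolvent_single_valued[OF assms(2,3)] unfolding JB_def by (auto dest: single_valuedD)
  moreover obtain u where "(b, u) \<in> B" "z = b + \<alpha> *\<^sub>R u"
    using b(1) by (auto simp: JB_def mem_resolvent_iff)
  moreover obtain a where "(x, a) \<in> A" "w = x + \<alpha> *\<^sub>R a"
    using w by (auto simp: mem_resolvent_iff)
  ultimately show ?thesis
    by (intro that[of b u c x a]) (auto simp: algebra_simps scaleR_2)
qed

lemma quadratic_bound_A:
  fixes b c x :: "'a::real_inner"
  assumes "0 < \<mu>" and c: "norm c \<le> L * norm b" and bc: "0 \<le> inner b c"
  shows "0 \<le> 2 * \<mu> * (norm x)\<^sup>2 + 2 * inner x c + L\<^sup>2 / (2 * \<mu>) * (norm (b - x))\<^sup>2" (is "0 \<le> ?E")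
proof -
  \<comment> \<open>the coefficient of \<open>\<parallel>x\<parallel>\<^sup>2\<close> in \<open>2 \<mu> ?E\<close>, needed to complete the square in \<open>x\<close>\<close>
  define p where "p = 4 * \<mu>\<^sup>2 + L\<^sup>2"
  have "0 < p"
    using \<open>0 < \<mu>\<close> by (simp add: p_def add_pos_nonneg)
  have "(norm c)\<^sup>2 \<le> L\<^sup>2 * (norm b)\<^sup>2"
    using power_mono[OF c norm_ge_zero, of 2] by (simp add: power_mult_distrib)
  \<comment> \<open>Completing the square in \<open>x\<close> leaves a remainder in which the L^4
    \<parallel>b\<parallel>^2 terms cancel. What stays is nonnegative by the two bounds on
    \<open>c\<close>.\<close>
  then have "0 \<le> 4 * \<mu>\<^sup>2 * (L\<^sup>2 * (norm b)\<^sup>2 - (norm c)\<^sup>2) + 4 * \<mu> * L\<^sup>2 * inner b c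
      + (norm (p *\<^sub>R x + (2 * \<mu>) *\<^sub>R c - L\<^sup>2 *\<^sub>R b))\<^sup>2"
    using \<open>0 < \<mu>\<close> bc by (intro add_nonneg_nonneg mult_nonneg_nonneg) auto
  also have "\<dots> = p * (4 * \<mu>\<^sup>2 * (norm x)\<^sup>2 + 4 * \<mu> * inner x c + L\<^sup>2 * (norm (b - x))\<^sup>2)"
    unfolding power2_norm_eq_inner p_def
    by (simp add: inner_diff inner_add inner_commute power2_eq_square algebra_simps)
  also have "\<dots> = p * (2 * \<mu>) * ?E"
    using \<open>0 < \<mu>\<close> by (simp add: field_simps power2_eq_square)
  finally have "0 \<le> p * (2 * \<mu>) * ?E" .
  moreover have "0 < p * (2 * \<mu>)"
    using \<open>0 < p\<close> \<open>0 < \<mu>\<close> by simp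
  ultimately show ?thesis
    using zero_le_mult_iff linorder_not_le by blast
qed

text \<open>Writing x = b - (b - x) and applying Cauchy-Schwarz bounds \<langle>x, c\<rangle> below
  by - L \<parallel>b - x\<parallel> \<parallel>b\<parallel>, after which 2 \<mu> times the
  expression dominates a perfect square in the two norms.\<close>

lemma quadratic_bound_B:
  fixes b c x :: "'a::real_inner"
  assumes "0 < \<mu>" and c: "norm c \<le> L * norm b" and bc: "0 \<le> inner b c"
  shows "0 \<le> 2 * \<mu> * (norm b)\<^sup>2 + 2 * inner x c + L\<^sup>2 / (2 * \<mu>) * (norm (b - x))\<^sup>2" (is "0 \<le> ?E")
proof -
  have "inner (b - x) c \<le> norm (b - x) * (L * norm b)"
    using norm_cauchy_schwarz[of "b - x" c] mult_left_mono[OF c norm_ge_zero[of "b - x"]] by linarith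
  then have "- (norm (b - x) * (L * norm b)) \<le> inner x c"
    using bc by (simp add: inner_diff)
  then have "4 * \<mu> * - (norm (b - x) * (L * norm b)) \<le> 4 * \<mu> * inner x c"
    using \<open>0 < \<mu>\<close> by (intro mult_left_mono) auto
  moreover have "0 \<le> (2 * \<mu> * norm b - L * norm (b - x))\<^sup>2"
    by simp
  ultimately have "0 \<le> 4 * \<mu>\<^sup>2 * (norm b)\<^sup>2 + 4 * \<mu> * inner x c + L\<^sup>2 * (norm (b - x))\<^sup>2"
    by (simp add: power2_eq_square algebra_simps)
  also have "\<dots> = 2 * \<mu> * ?E"
    using \<open>0 < \<mu>\<close> by (simp add: field_simps power2_eq_square)
  finally show ?thesis
    using \<open>0 < \<mu>\<close> by (simp add: zero_le_mult_iff)
qed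

text \<open>Serves both claims: one of the two moduli is set to 0, and the quadratic form
  \<open>nonneg\<close> is the only ingredient that differs.\<close>

lemma davis_yin_averaged:
  fixes A B C :: "('a::real_inner) rel"
  assumes A: "strongly_monotone_op \<mu>\<^sub>A A" and B: "strongly_monotone_op \<mu>\<^sub>B B" "0 \<le> \<mu>\<^sub>B"
    and C: "monotone_op C" "lipschitz_op L C"
    and "0 < \<alpha>" "0 \<le> k" "k < 2"
    and nonneg: "\<And>b c x :: 'a. norm c \<le> L * norm b \<Longrightarrow> 0 \<le> inner b c \<Longrightarrow>
      0 \<le> 2 * \<alpha> * \<mu>\<^sub>A * (norm x)\<^sup>2 + 2 * \<alpha> * \<mu>\<^sub>B * (norm b)\<^sup>2 + 2 * \<alpha> * inner x c + k / 2 * (norm (b - x))\<^sup>2"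
  shows "averaged_op (2 / (4 - k)) (davis_yin A B C \<alpha>)"
proof (rule averaged_opI)
  show "0 < 2 / (4 - k)" "2 / (4 - k) < 1"
    using \<open>k < 2\<close> by auto
  have mono_B: "monotone_op B"
    unfolding monotone_op_def
  proof (intro allI impI)
    fix x u y v assume "(x, u) \<in> B" "(y, v) \<in> B"
    then have "\<mu>\<^sub>B * (norm (x - y))\<^sup>2 \<le> inner (x - y) (u - v)"
      using B(1) by (simp add: strongly_monotone_op_def)
    moreover have "0 \<le> \<mu>\<^sub>B * (norm (x - y))\<^sup>2"
      using B(2) by simp
    ultimately show "0 \<le> inner (x - y) (u - v)"
      by linarith
  qed
  fix z t z' t' assume T: "(z, t) \<in> davis_yin A B C \<alpha>" "(z', t') \<in> davis_yin A B C \<alpha>"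
  obtain b u c x a where in1: "(b, u) \<in> B" "(b, c) \<in> C" "(x, a) \<in> A" and
    z: "z = b + \<alpha> *\<^sub>R u" and a: "\<alpha> *\<^sub>R a = b - x - \<alpha> *\<^sub>R u - \<alpha> *\<^sub>R c" and t: "t = \<alpha> *\<^sub>R u + x"
    using davis_yinE[OF T(1) mono_B less_imp_le[OF \<open>0 < \<alpha>\<close>]] .
  obtain b' u' c' x' a' where in2: "(b', u') \<in> B" "(b', c') \<in> C" "(x', a') \<in> A" and
    z': "z' = b' + \<alpha> *\<^sub>R u'" and a': "\<alpha> *\<^sub>R a' = b' - x' - \<alpha> *\<^sub>R u' - \<alpha> *\<^sub>R c'" and
    t': "t' = \<alpha> *\<^sub>R u' + x'"
    using davis_yinE[OF T(2) mono_B less_imp_le[OF \<open>0 < \<alpha>\<close>]] .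
  define db du dc dx da where d: "db = b - b'" "du = u - u'" "dc = c - c'" "dx = x - x'" "da = a - a'"
  have "\<mu>\<^sub>A * (norm dx)\<^sup>2 \<le> inner dx da"
    using A in1 in2 by (simp add: strongly_monotone_op_def d)
  then have "\<alpha> * (\<mu>\<^sub>A * (norm dx)\<^sup>2) \<le> \<alpha> * inner dx da"
    using \<open>0 < \<alpha>\<close> by simp
  also have "\<alpha> * inner dx da = inner dx (\<alpha> *\<^sub>R a - \<alpha> *\<^sub>R a')"
    by (simp add: d inner_diff algebra_simps)
  also have "\<alpha> *\<^sub>R a - \<alpha> *\<^sub>R a' = db - dx - \<alpha> *\<^sub>R du - \<alpha> *\<^sub>R dc"
    unfolding a a' d by (simp add: algebra_simps)
  finally have ineq_A:
    "\<alpha> * \<mu>\<^sub>A * (norm dx)\<^sup>2 \<le> inner dx db - (norm dx)\<^sup>2 - \<alpha> * inner dx du - \<alpha> * inner dx dc"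
    by (simp add: inner_diff power2_norm_eq_inner)
  have "\<mu>\<^sub>B * (norm db)\<^sup>2 \<le> inner db du"
    using B in1 in2 by (simp add: strongly_monotone_op_def d)
  then have ineq_B: "\<alpha> * \<mu>\<^sub>B * (norm db)\<^sup>2 \<le> \<alpha> * inner db du"
    using \<open>0 < \<alpha>\<close> by simp
  have "norm dc \<le> L * norm db" "0 \<le> inner db dc"
    using C in1 in2 by (simp_all add: lipschitz_op_def monotone_op_def d)
  note E = nonneg[OF this, of dx]
  have diffs: "t - t' = \<alpha> *\<^sub>R du + dx" "z - z' = db + \<alpha> *\<^sub>R du" "(z - t) - (z' - t') = db - dx"
    by (simp_all add: z z' t t' d algebra_simps)
  \<comment> \<open>This determines the averaging constant: 1 / \<theta> - 1 = 1 - k / 2 exactly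
    when \<theta> = 2 / (4 - k).\<close>
  have "(1 - 2 / (4 - k)) / (2 / (4 - k)) = 1 - k / 2"
    using \<open>k < 2\<close> by (simp add: field_simps)
  moreover have "(norm (\<alpha> *\<^sub>R du + dx))\<^sup>2 \<le> (norm (db + \<alpha> *\<^sub>R du))\<^sup>2 - (1 - k / 2) * (norm (db - dx))\<^sup>2"
  proof -
    \<comment> \<open>Twice \<open>ineq_A\<close> plus twice \<open>ineq_B\<close> bounds the
      right-hand side below by the form in \<open>E\<close> without its last term, hence by - k / 2
      \<parallel>db - dx\<parallel>^2.\<close>
    have "(norm (db + \<alpha> *\<^sub>R du))\<^sup>2 - (norm (\<alpha> *\<^sub>R du + dx))\<^sup>2 - (norm (db - dx))\<^sup>2
      = 2 * (\<alpha> * inner db du) - 2 * (\<alpha> * inner dx du) + 2 * inner dx db - 2 * (norm dx)\<^sup>2"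
      by (simp add: power2_norm_eq_inner inner_diff inner_add inner_commute algebra_simps)
    with ineq_A ineq_B E show ?thesis
      by (simp add: algebra_simps)
  qed
  ultimately show "(norm (t - t'))\<^sup>2
      \<le> (norm (z - z'))\<^sup>2 - (1 - 2 / (4 - k)) / (2 / (4 - k)) * (norm ((z - t) - (z' - t')))\<^sup>2"
    unfolding diffs by (simp only:)
qed

theorem theorem4p1:
  fixes A B C :: "('a::{real_inner, complete_space}) rel"
  assumes "monotone_op A" and "monotone_op B" and "monotone_op C"
  shows "(\<forall>\<mu>\<^sub>A L\<^sub>C \<alpha> :: real.
            0 < \<mu>\<^sub>A \<longrightarrow> 0 < L\<^sub>C \<longrightarrow> strongly_monotone_op \<mu>\<^sub>A A \<longrightarrow> lipschitz_op L\<^sub>C C \<longrightarrow>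
            \<alpha> \<in> {0<..<2 * \<mu>\<^sub>A / L\<^sub>C\<^sup>2} \<longrightarrow>
            averaged_op (2 / (4 - \<alpha> * L\<^sub>C\<^sup>2 / \<mu>\<^sub>A)) (davis_yin A B C \<alpha>)) \<and>
         (\<forall>\<mu>\<^sub>B L\<^sub>C \<alpha> :: real.
            0 < \<mu>\<^sub>B \<longrightarrow> 0 < L\<^sub>C \<longrightarrow> strongly_monotone_op \<mu>\<^sub>B B \<longrightarrow> lipschitz_op L\<^sub>C C \<longrightarrow>
            \<alpha> \<in> {0<..<2 * \<mu>\<^sub>B / L\<^sub>C\<^sup>2} \<longrightarrow>
            averaged_op (2 / (4 - \<alpha> * L\<^sub>C\<^sup>2 / \<mu>\<^sub>B)) (davis_yin A B C \<alpha>))"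
proof (intro conjI allI impI)
  fix \<mu> L \<alpha> :: real
  assume *: "0 < \<mu>" "0 < L" "strongly_monotone_op \<mu> A" "lipschitz_op L C"
    "\<alpha> \<in> {0<..<2 * \<mu> / L\<^sup>2}"
  show "averaged_op (2 / (4 - \<alpha> * L\<^sup>2 / \<mu>)) (davis_yin A B C \<alpha>)"
  proof (rule davis_yin_averaged)
    show "strongly_monotone_op 0 B"
      using assms(2) by (simp add: strongly_monotone_op_def monotone_op_def)
    fix b c x :: 'a assume "norm c \<le> L * norm b" "0 \<le> inner b c"
    \<comment> \<open>Scaling by \<alpha> turns the coefficient L^2 / (2 \<mu>) into k / 2 for k =
      \<alpha> L^2 / \<mu>.\<close>
    from mult_nonneg_nonneg[OF _ quadratic_bound_A[OF *(1) this, of x], of \<alpha>]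
    show "0 \<le> 2 * \<alpha> * \<mu> * (norm x)\<^sup>2 + 2 * \<alpha> * 0 * (norm b)\<^sup>2 + 2 * \<alpha> * inner x c
        + \<alpha> * L\<^sup>2 / \<mu> / 2 * (norm (b - x))\<^sup>2"
      using * by (simp add: distrib_left mult_ac)
  qed (use * assms in \<open>auto simp: field_simps\<close>)
next
  fix \<mu> L \<alpha> :: real
  assume *: "0 < \<mu>" "0 < L" "strongly_monotone_op \<mu> B" "lipschitz_op L C"
    "\<alpha> \<in> {0<..<2 * \<mu> / L\<^sup>2}"
  show "averaged_op (2 / (4 - \<alpha> * L\<^sup>2 / \<mu>)) (davis_yin A B C \<alpha>)"
  proof (rule davis_yin_averaged)
    show "strongly_monotone_op 0 A"
      using assms(1) by (simp add: strongly_monotone_op_def monotone_op_def)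
    fix b c x :: 'a assume "norm c \<le> L * norm b" "0 \<le> inner b c"
    from mult_nonneg_nonneg[OF _ quadratic_bound_B[OF *(1) this, of x], of \<alpha>]
    show "0 \<le> 2 * \<alpha> * 0 * (norm x)\<^sup>2 + 2 * \<alpha> * \<mu> * (norm b)\<^sup>2 + 2 * \<alpha> * inner x c
        + \<alpha> * L\<^sup>2 / \<mu> / 2 * (norm (b - x))\<^sup>2"
      using * by (simp add: distrib_left mult_ac)
  \<comment> \<open>The stepsize bound \<alpha> < 2 \<mu> / L^2 is precisely k < 2.\<close>
  qed (use * assms in \<open>auto simp: field_simps\<close>)
qed

end
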